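(* Let $D=(V,A)$ be a digraph, let $\{S,T\}$ be a partition of $V$ with $S,T\neq\emptyset$ such that $D$ has no arc from $T$ to $S$, and let $b\in\mathbb{Z}_{>0}^V$. Then the following linear system in the variable $x\in\mathbb{R}^A$ is box-totally dual integral: \begin{align*} &x(\delta^-(v))\ge b(v) && (v\in T),\\ &x(\delta^+(v))\ge b(v) && (v\in S),\\ &x(C)\ge 1 && (C \text{ a bicut}),\\ &x(a)\ge 0 && (a\in A). \end{align*}
   Context: Digraphs are loopless. For $X\subseteq V$, $\delta^-(X)$ (resp. $\delta^+(X)$) is the set of arcs of $A$ entering (resp. leaving) $X$, and $\delta^\pm(v)=\delta^\pm(\{v\})$. For $x\in\mathbb{R}^A$ and $F\subseteq A$, $x(F)=\sum_{a\in F}x(a)$. A bicut is an arc set of the form $\delta^-(U)$ for some $U\subseteq V$ with either $\emptyset\neq U\subseteq T$ or $T\subseteq U\subsetneq V$. *)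

theory Defs
  imports "HOL-Analysis.Analysis" "Graph_Theory.Digraph"
begin

definition lp_feasible ::
  "'i set \<Rightarrow> 'e set \<Rightarrow> ('i \<Rightarrow> 'e \<Rightarrow> real) \<Rightarrow> ('i \<Rightarrow> real) \<Rightarrow> ('e \<Rightarrow> real) \<Rightarrow> bool" where
  "lp_feasible I E a \<beta> x \<longleftrightarrow> (\<forall>i\<in>I. (\<Sum>e\<in>E. a i e * x e) \<ge> \<beta> i)"

definition primal_finite ::
  "'i set \<Rightarrow> 'e set \<Rightarrow> ('i \<Rightarrow> 'e \<Rightarrow> real) \<Rightarrow> ('i \<Rightarrow> real) \<Rightarrow> ('e \<Rightarrow> real) \<Rightarrow> bool" where
  "primal_finite I E a \<beta> c \<longleftrightarrow>
     (\<exists>x. lp_feasible I E a \<beta> x) \<and>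
     bdd_below {(\<Sum>e\<in>E. c e * x e) | x. lp_feasible I E a \<beta> x}"

definition dual_feasible ::
  "'i set \<Rightarrow> 'e set \<Rightarrow> ('i \<Rightarrow> 'e \<Rightarrow> real) \<Rightarrow> ('e \<Rightarrow> real) \<Rightarrow> ('i \<Rightarrow> real) \<Rightarrow> bool" where
  "dual_feasible I E a c y \<longleftrightarrow>
     (\<forall>i\<in>I. y i \<ge> 0) \<and> (\<forall>e\<in>E. (\<Sum>i\<in>I. y i * a i e) = c e)"

definition dual_optimal ::
  "'i set \<Rightarrow> 'e set \<Rightarrow> ('i \<Rightarrow> 'e \<Rightarrow> real) \<Rightarrow> ('i \<Rightarrow> real) \<Rightarrow> ('e \<Rightarrow> real) \<Rightarrow> ('i \<Rightarrow> real) \<Rightarrow> bool" where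
  "dual_optimal I E a \<beta> c y \<longleftrightarrow>
     dual_feasible I E a c y \<and>
     (\<forall>y'. dual_feasible I E a c y' \<longrightarrow> (\<Sum>i\<in>I. y' i * \<beta> i) \<le> (\<Sum>i\<in>I. y i * \<beta> i))"

definition TDI ::
  "'i set \<Rightarrow> 'e set \<Rightarrow> ('i \<Rightarrow> 'e \<Rightarrow> real) \<Rightarrow> ('i \<Rightarrow> real) \<Rightarrow> bool" where
  "TDI I E a \<beta> \<longleftrightarrow>
     (\<forall>c. (\<forall>e\<in>E. c e \<in> \<int>) \<longrightarrow> primal_finite I E a \<beta> c \<longrightarrow>
        (\<exists>y. dual_optimal I E a \<beta> c y \<and> (\<forall>i\<in>I. y i \<in> \<int>)))"

definition box_idx :: "'i set \<Rightarrow> 'e set \<Rightarrow> ('i + ('e + 'e)) set" where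
  "box_idx I E = Inl ` I \<union> Inr ` (Inl ` E \<union> Inr ` E)"

fun box_coef :: "('i \<Rightarrow> 'e \<Rightarrow> real) \<Rightarrow> ('i + ('e + 'e)) \<Rightarrow> 'e \<Rightarrow> real" where
  "box_coef a (Inl i) = a i"
| "box_coef a (Inr (Inl e)) = (\<lambda>f. if f = e then 1 else 0)"
| "box_coef a (Inr (Inr e)) = (\<lambda>f. if f = e then -1 else 0)"

fun box_rhs :: "('i \<Rightarrow> real) \<Rightarrow> ('e \<Rightarrow> real) \<Rightarrow> ('e \<Rightarrow> real) \<Rightarrow> ('i + ('e + 'e)) \<Rightarrow> real" where
  "box_rhs \<beta> l u (Inl i) = \<beta> i"
| "box_rhs \<beta> l u (Inr (Inl e)) = l e"
| "box_rhs \<beta> l u (Inr (Inr e)) = - u e"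

definition box_TDI ::
  "'i set \<Rightarrow> 'e set \<Rightarrow> ('i \<Rightarrow> 'e \<Rightarrow> real) \<Rightarrow> ('i \<Rightarrow> real) \<Rightarrow> bool" where
  "box_TDI I E a \<beta> \<longleftrightarrow>
     (\<forall>l u. (\<forall>e\<in>E. l e \<in> \<rat> \<and> u e \<in> \<rat>) \<longrightarrow>
        TDI (box_idx I E) E (box_coef a) (box_rhs \<beta> l u))"

definition delta_in :: "('v, 'b) pre_digraph \<Rightarrow> 'v set \<Rightarrow> 'b set" where
  "delta_in G U = {e \<in> arcs G. head G e \<in> U \<and> tail G e \<notin> U}"

definition delta_out :: "('v, 'b) pre_digraph \<Rightarrow> 'v set \<Rightarrow> 'b set" where
  "delta_out G U = {e \<in> arcs G. tail G e \<in> U \<and> head G e \<notin> U}"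

text \<open>U induces a bicut  delta_in U  (w.r.t. T).\<close>
definition bicut_set :: "('v, 'b) pre_digraph \<Rightarrow> 'v set \<Rightarrow> 'v set \<Rightarrow> bool" where
  "bicut_set G T U \<longleftrightarrow> U \<subseteq> verts G \<and>
     ((U \<noteq> {} \<and> U \<subseteq> T) \<or> (T \<subseteq> U \<and> U \<noteq> verts G))"

datatype ('v, 'b) bicut_con = InDeg 'v | OutDeg 'v | Cut "'v set" | NonNeg 'b

definition bicut_idx :: "('v, 'b) pre_digraph \<Rightarrow> 'v set \<Rightarrow> 'v set \<Rightarrow> ('v, 'b) bicut_con set" where
  "bicut_idx G S T = InDeg ` T \<union> OutDeg ` S \<union> Cut ` {U. bicut_set G T U} \<union> NonNeg ` arcs G"

fun bicut_coef :: "('v, 'b) pre_digraph \<Rightarrow> ('v, 'b) bicut_con \<Rightarrow> 'b \<Rightarrow> real" where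
  "bicut_coef G (InDeg v) = (\<lambda>e. if e \<in> delta_in G {v} then 1 else 0)"
| "bicut_coef G (OutDeg v) = (\<lambda>e. if e \<in> delta_out G {v} then 1 else 0)"
| "bicut_coef G (Cut U) = (\<lambda>e. if e \<in> delta_in G U then 1 else 0)"
| "bicut_coef G (NonNeg a) = (\<lambda>e. if e = a then 1 else 0)"

fun bicut_rhs :: "('v \<Rightarrow> int) \<Rightarrow> ('v, 'b) bicut_con \<Rightarrow> real" where
  "bicut_rhs b (InDeg v) = of_int (b v)"
| "bicut_rhs b (OutDeg v) = of_int (b v)"
| "bicut_rhs b (Cut U) = 1"
| "bicut_rhs b (NonNeg a) = 0"

end

(* The inequalities say x(delta^-(U)) >= f(U) for nonempty U in T and x(delta^+(W)) >= f(W) for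
   nonempty W in S, where f is b on singletons and 1 elsewhere; f is intersecting supermodular
   because b >= 1. With box constraints every dual is feasible, so it suffices to round dual
   solutions without losing value. Scale a solution by k so that it becomes integral up to a
   vanishing error, uncross it to laminar families on both sides, and distribute the k-fold
   multiset into k integral solutions so that each arc is covered by each part equally often up
   to rounding. The objective is piecewise linear with breaks at integers only, so the parts
   together have the value of the whole, and one part is at least as good as the average. Since
   integral solutions have values in a discrete set bounded by weak duality, the best of them is
   optimal. *)

theory Submission
  imports Defs
begin

section \<open>Penalty terms and the relaxed dual\<close>

text \<open>For \<open>L \<le> u\<close> this is \<open>min (L * s) (u * s)\<close>: the best value
  of an arc whose box rows must supply the dual amount \<open>s\<close>, a surplus being paid by the
  lower bound \<open>L\<close> and a deficit charged at the upper bound \<open>u\<close>.\<close>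

definition slack_val :: "real \<Rightarrow> real \<Rightarrow> real \<Rightarrow> real" where
  "slack_val L u s = (if s \<ge> 0 then L * s else u * s)"

lemma slack_val_mono:
  assumes "0 \<le> L" "L \<le> u" "s \<le> t"
  shows "slack_val L u s \<le> slack_val L u t"
proof (cases "s < 0 \<and> 0 \<le> t")
  case True
  with assms have "u * s \<le> 0" "0 \<le> L * t" by (auto simp: mult_nonneg_nonpos)
  with True show ?thesis by (simp add: slack_val_def)
next
  case False
  with assms show ?thesis
    using mult_left_mono[of s t L] mult_left_mono[of s t u] by (auto simp: slack_val_def)
qed

lemma slack_val_scale:
  "0 < k \<Longrightarrow> slack_val L u (k * s) = k * slack_val L u s"
  by (auto simp: slack_val_def zero_le_mult_iff)

lemma le_slack_val:
  assumes "L \<le> u" "r \<le> L * s" "r \<le> u * s"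
  shows "r \<le> slack_val L u s"
  using assms by (auto simp: slack_val_def)

text \<open>Each half-line carries a single linear piece, so splitting a slack can lose value only
  if the pieces have opposite signs.\<close>

lemma slack_val_sum_same_sign:
  assumes "(\<forall>j\<in>A. s j \<ge> 0) \<or> (\<forall>j\<in>A. s j \<le> 0)"
  shows "(\<Sum>j\<in>A. slack_val L u (s j)) = slack_val L u (\<Sum>j\<in>A. s j)"
  using assms
proof
  assume s: "\<forall>j\<in>A. s j \<ge> 0"
  then have "(\<Sum>j\<in>A. s j) \<ge> 0" by (simp add: sum_nonneg)
  with s show ?thesis by (simp add: slack_val_def sum_distrib_left)
next
  assume s: "\<forall>j\<in>A. s j \<le> 0"
  then have le: "(\<Sum>j\<in>A. s j) \<le> 0" by (simp add: sum_nonpos)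
  have eq: "slack_val L u t = u * t" if "t \<le> 0" for t
    using that by (auto simp: slack_val_def)
  show ?thesis using s le by (simp add: eq sum_distrib_left)
qed

text \<open>Eliminating the dual variables of the box and of the nonnegativity constraints leaves an
  unconstrained concave problem in the remaining dual variables \<open>w \<ge> 0\<close>. Each penalty term breaks
  only at slack 0, which is what makes rounding lossless.\<close>

definition relaxed_dual ::
  "'j set \<Rightarrow> 'e set \<Rightarrow> ('j \<Rightarrow> 'e \<Rightarrow> real) \<Rightarrow> ('j \<Rightarrow> real) \<Rightarrow> ('e \<Rightarrow> real) \<Rightarrow> ('e \<Rightarrow> real) \<Rightarrow>
    ('e \<Rightarrow> real) \<Rightarrow> ('j \<Rightarrow> real) \<Rightarrow> real" where
  "relaxed_dual J E M f L u c w =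
     (\<Sum>j\<in>J. w j * f j) + (\<Sum>e\<in>E. slack_val (L e) (u e) (c e - (\<Sum>j\<in>J. w j * M j e)))"

text \<open>The integral vector \<open>z\<close> stands for the fractional dual
  \<open>z / k\<close>: by positive homogeneity the left side is \<open>k\<close> times the value of
  \<open>z / k\<close>, and some integral \<open>w\<close> must do at least as well.\<close>

definition roundable ::
  "'j set \<Rightarrow> 'e set \<Rightarrow> ('j \<Rightarrow> 'e \<Rightarrow> real) \<Rightarrow> ('j \<Rightarrow> real) \<Rightarrow> bool" where
  "roundable J E M f \<longleftrightarrow>
     (\<forall>c L u (z :: 'j \<Rightarrow> nat) (k :: nat). (\<forall>e\<in>E. c e \<in> \<int>) \<longrightarrow> (\<forall>e\<in>E. 0 \<le> L e \<and> L e \<le> u e) \<longrightarrow> 0 < k \<longrightarrow>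
       (\<exists>w :: 'j \<Rightarrow> nat. relaxed_dual J E M f L u (\<lambda>e. of_nat k * c e) (\<lambda>j. of_nat (z j))
          \<le> of_nat k * relaxed_dual J E M f L u c (\<lambda>j. of_nat (w j))))"

text \<open>Penalties grow with the slack, so uncrossing, which gains in \<open>f\<close> and covers
  no element more often, never lowers the value.\<close>

lemma relaxed_dual_mono:
  assumes LU: "\<And>e. e \<in> E \<Longrightarrow> 0 \<le> L e \<and> L e \<le> u e"
    and f: "(\<Sum>j\<in>J. w j * f j) \<le> (\<Sum>j\<in>J. w' j * f j)"
    and M: "\<And>e. e \<in> E \<Longrightarrow> (\<Sum>j\<in>J. w' j * M j e) \<le> (\<Sum>j\<in>J. w j * M j e)"
  shows "relaxed_dual J E M f L u c w \<le> relaxed_dual J E M f L u c w'"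
  unfolding relaxed_dual_def
  by (intro add_mono f sum_mono slack_val_mono) (use LU M in auto)

section \<open>Integral optima of the relaxed dual\<close>

lemma common_denominator:
  fixes r :: "'a \<Rightarrow> real"
  assumes "finite A" "\<forall>a\<in>A. r a \<in> \<rat>"
  shows "\<exists>D::nat. D > 0 \<and> (\<forall>a\<in>A. of_nat D * r a \<in> \<int>)"
  using assms
proof (induction A rule: finite_induct)
  case empty
  then show ?case by (intro exI[of _ 1]) simp
next
  case (insert x A)
  then obtain D :: nat where D: "D > 0" "\<forall>a\<in>A. of_nat D * r a \<in> \<int>" by auto
  from insert.prems have "r x \<in> \<rat>" by simp
  then obtain p q :: int where pq: "q > 0" "r x = of_int p / of_int q"
    by (metis Rats_cases')
  have x: "of_int q * r x \<in> \<int>" using pq by simp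
  have "of_nat (D * nat q) * r a \<in> \<int>" if "a \<in> insert x A" for a
  proof (cases "a = x")
    case True
    have "of_nat D * (of_int q * r x) \<in> \<int>" by (rule Ints_mult[OF Ints_of_nat x])
    moreover have "of_nat (D * nat q) * r a = of_nat D * (of_int q * r x)"
      using True \<open>q > 0\<close> by simp
    ultimately show ?thesis by metis
  next
    case False
    with D that have "of_nat D * r a \<in> \<int>" by auto
    from Ints_mult[OF Ints_of_int[of q] this] show ?thesis using \<open>q > 0\<close> by (simp add: ac_simps)
  qed
  with D pq show ?case by (intro exI[of _ "D * nat q"]) auto
qed

text \<open>The gap between \<open>D * F w\<close> and the floor of \<open>D * B\<close> is a
  natural number; a \<open>w\<close> with the smallest gap is a maximizer.\<close>

lemma discrete_bounded_has_max:
  fixes F :: "'a \<Rightarrow> real" and D :: nat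
  assumes D: "D > 0" and int: "\<And>w. of_nat D * F w \<in> \<int>" and bd: "\<And>w. F w \<le> B"
  shows "\<exists>w. \<forall>w'. F w' \<le> F w"
proof -
  define m where "m w = nat (\<lfloor>of_nat D * B\<rfloor> - \<lfloor>of_nat D * F w\<rfloor>)" for w
  obtain w where w: "\<And>w'. m w \<le> m w'" using ex_has_least_nat[of "\<lambda>_. True" _ m] by blast
  have "F w' \<le> F w" for w'
  proof -
    have "\<lfloor>of_nat D * F v\<rfloor> \<le> \<lfloor>of_nat D * B\<rfloor>" for v
      by (intro floor_mono mult_left_mono bd) auto
    with w[of w'] have "\<lfloor>of_nat D * F w'\<rfloor> \<le> \<lfloor>of_nat D * F w\<rfloor>"
      unfolding m_def by (smt (verit) nat_le_eq_zle)
    moreover have "of_int \<lfloor>of_nat D * F v\<rfloor> = of_nat D * F v" for v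
      using int[of v] by (metis Ints_cases floor_of_int)
    ultimately have "of_nat D * F w' \<le> of_nat D * F w"
      by (metis of_int_le_iff)
    with D show ?thesis by simp
  qed
  then show ?thesis by blast
qed

text \<open>Rational bounds confine the values of integral vectors to multiples of one fraction, so
  a best integral \<open>w\<close> exists. A real \<open>y\<close> is compared with it by scaling,
  rounding down, applying \<open>roundable\<close> and letting the loss per unit of scale
  vanish.\<close>

lemma roundable_integral_optimum:
  fixes M :: "'j \<Rightarrow> 'e \<Rightarrow> real" and c L u :: "'e \<Rightarrow> real"
  assumes fin: "finite E"
    and round: "roundable J E M f"
    and M: "\<And>j e. j \<in> J \<Longrightarrow> e \<in> E \<Longrightarrow> M j e \<in> \<int> \<and> 0 \<le> M j e"
    and f: "\<And>j. j \<in> J \<Longrightarrow> f j \<in> \<int> \<and> 0 \<le> f j"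
    and c: "\<And>e. e \<in> E \<Longrightarrow> c e \<in> \<int>"
    and LU: "\<And>e. e \<in> E \<Longrightarrow> 0 \<le> L e \<and> L e \<le> u e"
    and rat: "\<And>e. e \<in> E \<Longrightarrow> L e \<in> \<rat> \<and> u e \<in> \<rat>"
    and bd: "\<And>w :: 'j \<Rightarrow> nat. relaxed_dual J E M f L u c (\<lambda>j. of_nat (w j)) \<le> B"
  shows "\<exists>w :: 'j \<Rightarrow> nat. \<forall>y. (\<forall>j\<in>J. y j \<ge> 0) \<longrightarrow>
    relaxed_dual J E M f L u c y \<le> relaxed_dual J E M f L u c (\<lambda>j. of_nat (w j))"
proof -
  let ?R = "\<lambda>c w. relaxed_dual J E M f L u c w"
  obtain D1 :: nat where D1: "D1 > 0" "\<forall>e\<in>E. of_nat D1 * L e \<in> \<int>"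
    using common_denominator[OF fin, of L] rat by auto
  obtain D2 :: nat where D2: "D2 > 0" "\<forall>e\<in>E. of_nat D2 * u e \<in> \<int>"
    using common_denominator[OF fin, of u] rat by auto
  let ?D = "D1 * D2"
  have int: "of_nat ?D * ?R c (\<lambda>j. of_nat (w j)) \<in> \<int>" for w :: "'j \<Rightarrow> nat"
  proof -
    have "of_nat ?D * slack_val (L e) (u e) (c e - (\<Sum>j\<in>J. of_nat (w j) * M j e)) \<in> \<int>"
      if e: "e \<in> E" for e
    proof -
      define s where "s = c e - (\<Sum>j\<in>J. of_nat (w j) * M j e)"
      have s: "s \<in> \<int>" unfolding s_def using M c e
        by (intro Ints_diff Ints_sum Ints_mult) auto
      have "of_nat D2 * (of_nat D1 * L e) * s \<in> \<int>" "of_nat D1 * (of_nat D2 * u e) * s \<in> \<int>"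
        using D1 D2 e s by (auto intro!: Ints_mult)
      then show ?thesis
        unfolding s_def[symmetric] by (simp add: slack_val_def ac_simps)
    qed
    moreover have "of_nat ?D * (of_nat (w j) * f j) \<in> \<int>" if "j \<in> J" for j
      using f that by (intro Ints_mult) auto
    ultimately show ?thesis
      unfolding relaxed_dual_def distrib_left sum_distrib_left
      by (intro Ints_add Ints_sum) auto
  qed
  obtain w :: "'j \<Rightarrow> nat" where w: "\<And>w' :: 'j \<Rightarrow> nat. ?R c (\<lambda>j. of_nat (w' j)) \<le> ?R c (\<lambda>j. of_nat (w j))"
    using discrete_bounded_has_max[of ?D "\<lambda>w :: 'j \<Rightarrow> nat. ?R c (\<lambda>j. of_nat (w j))", OF _ int bd]
      D1(1) D2(1) by (metis nat_0_less_mult_iff)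
  have "?R c y \<le> ?R c (\<lambda>j. of_nat (w j))" if y: "\<forall>j\<in>J. y j \<ge> 0" for y
  proof (rule field_le_epsilon)
    fix \<epsilon> :: real assume "\<epsilon> > 0"
    define C where "C = (\<Sum>j\<in>J. f j)"
    \<comment> \<open>\<open>C\<close> bounds the total loss caused by rounding down, so this
      \<open>k\<close> leaves at most \<open>\<epsilon>\<close> after division; the maximum with 0
      forces \<open>k > 0\<close>.\<close>
    obtain k :: nat where "max (C / \<epsilon>) 0 < of_nat k" using reals_Archimedean2 by blast
    then have k: "C / \<epsilon> < of_nat k" "k > 0" by auto
    then have Ck: "C \<le> of_nat k * \<epsilon>" using \<open>\<epsilon> > 0\<close> by (simp add: field_simps)
    define z where "z j = nat \<lfloor>of_nat k * y j\<rfloor>" for j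
    have z: "of_nat (z j) \<le> of_nat k * y j \<and> of_nat k * y j \<le> of_nat (z j) + 1" if "j \<in> J" for j
    proof -
      have "0 \<le> of_nat k * y j" using y that by simp
      then show ?thesis unfolding z_def by (auto simp: of_nat_nat)
    qed
    have "(\<Sum>j\<in>J. of_nat k * y j * f j) \<le> (\<Sum>j\<in>J. (of_nat (z j) + 1) * f j)"
      by (intro sum_mono mult_right_mono) (use z f in auto)
    also have "\<dots> = (\<Sum>j\<in>J. of_nat (z j) * f j) + C"
      by (simp add: C_def distrib_right sum.distrib)
    finally have fz: "(\<Sum>j\<in>J. of_nat k * y j * f j) \<le> (\<Sum>j\<in>J. of_nat (z j) * f j) + C" .
    \<comment> \<open>Rounding down lowers coverage and thus raises slack, so only the linear term
      can lose.\<close>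
    have "of_nat k * slack_val (L e) (u e) (c e - (\<Sum>j\<in>J. y j * M j e))
        \<le> slack_val (L e) (u e) (of_nat k * c e - (\<Sum>j\<in>J. of_nat (z j) * M j e))" if e: "e \<in> E" for e
    proof -
      have "(\<Sum>j\<in>J. of_nat (z j) * M j e) \<le> (\<Sum>j\<in>J. of_nat k * y j * M j e)"
        by (intro sum_mono mult_right_mono) (use z M e in auto)
      then have "of_nat k * (c e - (\<Sum>j\<in>J. y j * M j e))
          \<le> of_nat k * c e - (\<Sum>j\<in>J. of_nat (z j) * M j e)"
        by (simp add: right_diff_distrib sum_distrib_left mult.assoc)
      then show ?thesis
        using slack_val_scale[of "of_nat k"] slack_val_mono LU[OF e] k(2) by (metis of_nat_0_less_iff)
    qed
    then have "of_nat k * ?R c y \<le> ?R (\<lambda>e. of_nat k * c e) (\<lambda>j. of_nat (z j)) + C"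
      using fz unfolding relaxed_dual_def distrib_left sum_distrib_left
      by (smt (verit, best) sum_mono sum.cong mult.assoc)
    moreover obtain w' :: "'j \<Rightarrow> nat" where
      "?R (\<lambda>e. of_nat k * c e) (\<lambda>j. of_nat (z j)) \<le> of_nat k * ?R c (\<lambda>j. of_nat (w' j))"
      using round c LU k(2) unfolding roundable_def by blast
    moreover have "of_nat k * ?R c (\<lambda>j. of_nat (w' j)) \<le> of_nat k * ?R c (\<lambda>j. of_nat (w j))"
      by (intro mult_left_mono w) auto
    ultimately have "of_nat k * ?R c y \<le> of_nat k * (?R c (\<lambda>j. of_nat (w j)) + \<epsilon>)"
      using Ck by (simp add: distrib_left)
    with k(2) show "?R c y \<le> ?R c (\<lambda>j. of_nat (w j)) + \<epsilon>" by simp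
  qed
  then show ?thesis by blast
qed

section \<open>Transfer to the duals of boxed systems\<close>

text \<open>Multipliers of rows with the same image under \<open>g\<close> are merged; this moves
  duals in both directions between rows and their representatives.\<close>

lemma sum_pushforward:
  fixes r :: "'i \<Rightarrow> 'a :: comm_semiring_0"
  assumes "finite I" "finite J" "g ` J \<subseteq> I"
  shows "(\<Sum>i\<in>I. (\<Sum>j | j \<in> J \<and> g j = i. w j) * r i) = (\<Sum>j\<in>J. w j * r (g j))"
proof -
  have "(\<Sum>i\<in>I. (\<Sum>j | j \<in> J \<and> g j = i. w j) * r i)
      = (\<Sum>i\<in>I. \<Sum>j | j \<in> J \<and> g j = i. w j * r (g j))"
    unfolding sum_distrib_right by (intro sum.cong) auto
  also have "\<dots> = (\<Sum>j\<in>J. w j * r (g j))"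
    using assms by (intro sum.group) auto
  finally show ?thesis .
qed


lemma weak_duality:
  assumes x: "lp_feasible K E A r x" and y: "dual_feasible K E A c y"
  shows "(\<Sum>i\<in>K. y i * r i) \<le> (\<Sum>e\<in>E. c e * x e)"
proof -
  have "(\<Sum>i\<in>K. y i * r i) \<le> (\<Sum>i\<in>K. y i * (\<Sum>e\<in>E. A i e * x e))"
    using x y by (intro sum_mono mult_left_mono) (auto simp: lp_feasible_def dual_feasible_def)
  also have "\<dots> = (\<Sum>e\<in>E. (\<Sum>i\<in>K. y i * A i e) * x e)"
    unfolding sum_distrib_left sum_distrib_right by (subst sum.swap) (simp add: mult.assoc)
  also have "\<dots> = (\<Sum>e\<in>E. c e * x e)"
    using y by (intro sum.cong) (auto simp: dual_feasible_def)
  finally show ?thesis .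
qed

text \<open>The rows \<open>x(e) \<ge> 0\<close>, indexed through \<open>N\<close>, are kept apart
  so that each joins the two box rows of the same \<open>e\<close>: these three alone absorb the
  slack of \<open>e\<close>.\<close>

locale nonneg_system =
  fixes I0 :: "'i set" and E :: "'e set" and a :: "'i \<Rightarrow> 'e \<Rightarrow> real" and \<beta> :: "'i \<Rightarrow> real"
    and N :: "'e \<Rightarrow> 'i"
  assumes finite_I0: "finite I0" and finite_E: "finite E"
    and inj_N: "inj_on N E" and N_notin: "N ` E \<inter> I0 = {}"
    and coef_N: "e \<in> E \<Longrightarrow> a (N e) = (\<lambda>e'. if e' = e then 1 else 0)"
    and rhs_N: "e \<in> E \<Longrightarrow> \<beta> (N e) = 0"
begin

abbreviation "I \<equiv> I0 \<union> N ` E"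

lemma sum_box_idx:
  fixes F :: "'i + 'e + 'e \<Rightarrow> real"
  shows "(\<Sum>i\<in>box_idx I E. F i) =
    (\<Sum>i\<in>I0. F (Inl i)) + (\<Sum>e\<in>E. F (Inl (N e)) + F (Inr (Inl e)) + F (Inr (Inr e)))"
proof -
  have "(\<Sum>i\<in>box_idx I E. F i) = (\<Sum>i\<in>I. F (Inl i)) + (\<Sum>i\<in>Inl ` E \<union> Inr ` E. F (Inr i))"
    unfolding box_idx_def using finite_I0 finite_E
    by (subst sum.union_disjoint) (auto simp: sum.reindex)
  also have "(\<Sum>i\<in>I. F (Inl i)) = (\<Sum>i\<in>I0. F (Inl i)) + (\<Sum>e\<in>E. F (Inl (N e)))"
    using finite_I0 finite_E N_notin inj_N
    by (subst sum.union_disjoint) (auto simp: sum.reindex)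
  also have "(\<Sum>i\<in>Inl ` E \<union> Inr ` E. F (Inr i)) = (\<Sum>e\<in>E. F (Inr (Inl e))) + (\<Sum>e\<in>E. F (Inr (Inr e)))"
    using finite_E by (subst sum.union_disjoint) (auto simp: sum.reindex)
  finally show ?thesis by (simp add: sum.distrib)
qed

lemma box_dual_coef:
  assumes "e \<in> E"
  shows "(\<Sum>i\<in>box_idx I E. y i * box_coef a i e) =
    (\<Sum>i\<in>I0. y (Inl i) * a i e) + (y (Inl (N e)) + y (Inr (Inl e)) - y (Inr (Inr e)))"
proof -
  have "(\<Sum>e'\<in>E. y (Inl (N e')) * a (N e') e + y (Inr (Inl e')) * (if e = e' then 1 else 0)
      + y (Inr (Inr e')) * (if e = e' then - 1 else 0))
    = (\<Sum>e'\<in>E. if e = e' then y (Inl (N e)) + y (Inr (Inl e)) - y (Inr (Inr e)) else 0)"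
    by (intro sum.cong) (auto simp: coef_N)
  with assms finite_E show ?thesis by (simp add: sum_box_idx)
qed

lemma box_dual_value:
  "(\<Sum>i\<in>box_idx I E. y i * box_rhs \<beta> l u i) =
    (\<Sum>i\<in>I0. y (Inl i) * \<beta> i) + (\<Sum>e\<in>E. y (Inr (Inl e)) * l e - y (Inr (Inr e)) * u e)"
  by (simp add: sum_box_idx rhs_N)

text \<open>\<open>J\<close> indexes the strongest rows. Along \<open>h\<close> every dual solution
  becomes a relaxed one of no smaller value; along \<open>g\<close> every integral relaxed solution
  becomes an integral dual solution of equal value. So an integral optimum of the relaxed dual
  yields one of the dual.\<close>

lemma box_TDI_if_roundable:
  fixes J :: "'j set" and f :: "'j \<Rightarrow> real" and g :: "'j \<Rightarrow> 'i" and h :: "'i \<Rightarrow> 'j"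
  assumes fin_J: "finite J"
    and M: "\<And>j e. j \<in> J \<Longrightarrow> e \<in> E \<Longrightarrow> M j e \<in> \<int> \<and> 0 \<le> M j e"
    and f: "\<And>j. j \<in> J \<Longrightarrow> f j \<in> \<int> \<and> 0 \<le> f j"
    and g: "\<And>j. j \<in> J \<Longrightarrow> g j \<in> I0 \<and> (\<forall>e\<in>E. a (g j) e = M j e) \<and> \<beta> (g j) = f j"
    and h: "\<And>i. i \<in> I0 \<Longrightarrow> h i \<in> J \<and> (\<forall>e\<in>E. M (h i) e = a i e) \<and> \<beta> i \<le> f (h i)"
    and round: "roundable J E M f"
  shows "box_TDI I E a \<beta>"
  unfolding box_TDI_def TDI_def
proof (intro allI impI)
  fix l u c :: "'e \<Rightarrow> real"
  assume rat: "\<forall>e\<in>E. l e \<in> \<rat> \<and> u e \<in> \<rat>" and c: "\<forall>e\<in>E. c e \<in> \<int>"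
    and pf: "primal_finite (box_idx I E) E (box_coef a) (box_rhs \<beta> l u) c"
  let ?feas = "dual_feasible (box_idx I E) E (box_coef a) c"
  let ?val = "\<lambda>y. \<Sum>i\<in>box_idx I E. y i * box_rhs \<beta> l u i"
  \<comment> \<open>The rows \<open>x(e) \<ge> 0\<close> turn \<open>max (l e) 0\<close> into the
    effective lower bound.\<close>
  define L where "L e = max (l e) 0" for e
  let ?R = "\<lambda>w. relaxed_dual J E M f L u c w"
  obtain x where x: "lp_feasible (box_idx I E) E (box_coef a) (box_rhs \<beta> l u) x"
    using pf by (auto simp: primal_finite_def)
  have LU: "0 \<le> L e \<and> L e \<le> u e" if e: "e \<in> E" for e
  proof -
    have pick: "(\<Sum>f\<in>E. (if f = e then r else 0) * x f) = r * x e" for r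
    proof -
      have "(\<Sum>f\<in>E. (if f = e then r else 0) * x f) = (\<Sum>f\<in>E. if f = e then r * x e else 0)"
        by (intro sum.cong) auto
      with e finite_E show ?thesis by simp
    qed
    have *: "box_rhs \<beta> l u i \<le> (\<Sum>f\<in>E. box_coef a i f * x f)" if "i \<in> box_idx I E" for i
      using x that by (auto simp: lp_feasible_def)
    have "0 \<le> x e" using *[of "Inl (N e)"] e by (simp add: box_idx_def coef_N rhs_N pick)
    moreover have "l e \<le> x e" using *[of "Inr (Inl e)"] e by (simp add: box_idx_def pick)
    moreover have "x e \<le> u e" using *[of "Inr (Inr e)"] e by (simp add: box_idx_def pick)
    ultimately show ?thesis by (auto simp: L_def)
  qed
  define slack where "slack w e = c e - (\<Sum>j\<in>J. of_nat (w j) * M j e)" for w :: "'j \<Rightarrow> nat" and e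
  \<comment> \<open>A nonnegative slack goes to the stronger of the rows \<open>x(e) \<ge> 0\<close>
    and \<open>x(e) \<ge> l(e)\<close>, a negative one to the upper bound row, so the value per unit
    is that of the penalty term.\<close>
  define lift :: "('j \<Rightarrow> nat) \<Rightarrow> 'i + 'e + 'e \<Rightarrow> real" where
    "lift w i = (case i of
        Inl i \<Rightarrow> if i \<in> I0 then of_nat (\<Sum>j | j \<in> J \<and> g j = i. w j)
          else (let s = slack w (the_inv_into E N i) in if s \<ge> 0 \<and> l (the_inv_into E N i) < 0 then s else 0)
      | Inr (Inl e) \<Rightarrow> if slack w e \<ge> 0 \<and> \<not> l e < 0 then slack w e else 0
      | Inr (Inr e) \<Rightarrow> if slack w e < 0 then - slack w e else 0)" for w i
  have lift_I0: "(\<Sum>i\<in>I0. lift w (Inl i) * r i) = (\<Sum>j\<in>J. of_nat (w j) * r (g j))" for w and r :: "'i \<Rightarrow> real"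
    using sum_pushforward[OF finite_I0 fin_J, of g "\<lambda>j. of_nat (w j) :: real" r] g
    by (force simp: lift_def)
  have lift_N: "lift w (Inl (N e)) = (if slack w e \<ge> 0 \<and> l e < 0 then slack w e else 0)" if "e \<in> E" for w e
  proof -
    have "N e \<notin> I0" using N_notin that by auto
    then show ?thesis using the_inv_into_f_f[OF inj_N that] by (simp add: lift_def Let_def)
  qed
  have lift_feas: "?feas (lift w)" for w
    unfolding dual_feasible_def
  proof (intro conjI ballI)
    fix i
    show "0 \<le> lift w i"
    proof (cases i)
      case (Inr e)
      then show ?thesis by (cases e) (simp_all add: lift_def)
    qed (simp add: lift_def Let_def sum_nonneg)
  next
    fix e assume e: "e \<in> E"
    have "(\<Sum>i\<in>I0. lift w (Inl i) * a i e) = (\<Sum>j\<in>J. of_nat (w j) * M j e)"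
      unfolding lift_I0 using g e by (intro sum.cong) auto
    moreover have "lift w (Inl (N e)) + lift w (Inr (Inl e)) - lift w (Inr (Inr e)) = slack w e"
      unfolding lift_N[OF e] by (auto simp: lift_def)
    ultimately show "(\<Sum>i\<in>box_idx I E. lift w i * box_coef a i e) = c e"
      unfolding box_dual_coef[OF e] by (simp add: slack_def)
  qed
  have lift_val: "?val (lift w) = ?R (\<lambda>j. of_nat (w j))" for w
  proof -
    have "lift w (Inr (Inl e)) * l e - lift w (Inr (Inr e)) * u e = slack_val (L e) (u e) (slack w e)" for e
      by (auto simp: lift_def slack_val_def L_def)
    moreover have "(\<Sum>i\<in>I0. lift w (Inl i) * \<beta> i) = (\<Sum>j\<in>J. of_nat (w j) * f j)"
      unfolding lift_I0 using g by (intro sum.cong) auto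
    ultimately show ?thesis
      unfolding box_dual_value relaxed_dual_def by (simp add: slack_def)
  qed
  have lift_int: "lift w i \<in> \<int>" if i: "i \<in> box_idx I E" for w i
  proof -
    have slack_int: "slack w e \<in> \<int>" if "e \<in> E" for e
      unfolding slack_def using c M that by (intro Ints_diff Ints_sum Ints_mult) auto
    consider i' where "i = Inl i'" "i' \<in> I0" | e where "e \<in> E" "i = Inl (N e)"
      | e where "e \<in> E" "i = Inr (Inl e)" | e where "e \<in> E" "i = Inr (Inr e)"
      using i unfolding box_idx_def by blast
    then show ?thesis
    proof cases
      case (1 i')
      then show ?thesis by (simp add: lift_def Ints_sum)
    next
      case (2 e)
      with slack_int show ?thesis by (simp add: lift_N)
    qed (use slack_int in \<open>simp_all add: lift_def\<close>)
  qed
  have bd: "?R (\<lambda>j. of_nat (w j)) \<le> (\<Sum>e\<in>E. c e * x e)" for w :: "'j \<Rightarrow> nat"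
    using weak_duality[OF x lift_feas, of w] by (simp add: lift_val)
  have ub: "\<exists>Y. (\<forall>j\<in>J. Y j \<ge> 0) \<and> ?val y \<le> ?R Y" if y: "?feas y" for y
  proof -
    define Y where "Y j = (\<Sum>i | i \<in> I0 \<and> h i = j. y (Inl i))" for j
    have y0: "0 \<le> y i" if "i \<in> box_idx I E" for i using y that by (auto simp: dual_feasible_def)
    have Y: "(\<Sum>j\<in>J. Y j * r j) = (\<Sum>i\<in>I0. y (Inl i) * r (h i))" for r
      unfolding Y_def using h by (intro sum_pushforward finite_I0 fin_J) auto
    have "(\<Sum>i\<in>I0. y (Inl i) * \<beta> i) \<le> (\<Sum>j\<in>J. Y j * f j)"
      unfolding Y using h y0 by (intro sum_mono mult_left_mono) (auto simp: box_idx_def)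
    moreover have "y (Inr (Inl e)) * l e - y (Inr (Inr e)) * u e
        \<le> slack_val (L e) (u e) (c e - (\<Sum>j\<in>J. Y j * M j e))" if e: "e \<in> E" for e
    proof -
      let ?n = "y (Inl (N e))" and ?p = "y (Inr (Inl e))" and ?q = "y (Inr (Inr e))"
      have nn: "0 \<le> ?n" "0 \<le> ?p" "0 \<le> ?q" using y0 e by (auto simp: box_idx_def)
      have "(\<Sum>j\<in>J. Y j * M j e) = (\<Sum>i\<in>I0. y (Inl i) * a i e)"
        unfolding Y using h e by (intro sum.cong) auto
      then have s: "c e - (\<Sum>j\<in>J. Y j * M j e) = ?n + ?p - ?q"
        using y e box_dual_coef[OF e, of y] by (simp add: dual_feasible_def)
      \<comment> \<open>Writing \<open>s\<close> for the slack, these give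
        \<open>?p * l e - ?q * u e\<close> at most \<open>L e * s\<close> and at most
        \<open>u e * s\<close>, the two linear pieces of the penalty.\<close>
      have "?p * l e \<le> ?p * L e" "0 \<le> ?n * L e" "?q * L e \<le> ?q * u e"
        "?p * L e \<le> ?p * u e" "0 \<le> ?n * u e"
        using nn LU[OF e] by (auto simp: L_def intro: mult_left_mono)
      then show ?thesis
        unfolding s using LU[OF e] by (intro le_slack_val) (auto simp: algebra_simps)
    qed
    then have "(\<Sum>e\<in>E. y (Inr (Inl e)) * l e - y (Inr (Inr e)) * u e)
        \<le> (\<Sum>e\<in>E. slack_val (L e) (u e) (c e - (\<Sum>j\<in>J. Y j * M j e)))"
      by (rule sum_mono)
    ultimately have "?val y \<le> ?R Y"
      unfolding box_dual_value relaxed_dual_def by (rule add_mono)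
    moreover have "\<forall>j\<in>J. Y j \<ge> 0"
      unfolding Y_def using y0 by (auto simp: box_idx_def intro!: sum_nonneg)
    ultimately show ?thesis by blast
  qed
  obtain w :: "'j \<Rightarrow> nat" where w: "\<And>Y. \<forall>j\<in>J. Y j \<ge> 0 \<Longrightarrow> ?R Y \<le> ?R (\<lambda>j. of_nat (w j))"
  proof -
    have "L e \<in> \<rat> \<and> u e \<in> \<rat>" if "e \<in> E" for e
      using rat that by (auto simp: L_def max_def)
    then show ?thesis
      using roundable_integral_optimum[OF finite_E round M f _ LU _ bd] c that by blast
  qed
  show "\<exists>y. dual_optimal (box_idx I E) E (box_coef a) (box_rhs \<beta> l u) c y \<and> (\<forall>i\<in>box_idx I E. y i \<in> \<int>)"
  proof (intro exI conjI ballI)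
    show "dual_optimal (box_idx I E) E (box_coef a) (box_rhs \<beta> l u) c (lift w)"
      unfolding dual_optimal_def
    proof (intro conjI allI impI lift_feas)
      fix y assume "?feas y"
      then obtain Y where "\<forall>j\<in>J. Y j \<ge> 0" "?val y \<le> ?R Y" using ub by blast
      with w[of Y] show "?val y \<le> ?val (lift w)" unfolding lift_val by linarith
    qed
  qed (rule lift_int)
qed

end


section \<open>Uncrossing to laminar families\<close>

definition laminar :: "'a set set \<Rightarrow> bool" where
  "laminar F \<longleftrightarrow> (\<forall>X\<in>F. \<forall>Y\<in>F. X \<inter> Y = {} \<or> X \<subseteq> Y \<or> Y \<subseteq> X)"

definition intersecting_supermodular_on :: "'a set \<Rightarrow> ('a set \<Rightarrow> real) \<Rightarrow> bool" where
  "intersecting_supermodular_on T f \<longleftrightarrow>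
    (\<forall>X Y. X \<subseteq> T \<longrightarrow> Y \<subseteq> T \<longrightarrow> X \<inter> Y \<noteq> {} \<longrightarrow> f X + f Y \<le> f (X \<inter> Y) + f (X \<union> Y))"

text \<open>Termination measure of uncrossing. In terms of the sizes of the four regions cut out by
  \<open>X\<close> and \<open>Y\<close>, the decrease is \<open>2 * p * q\<close>, which is positive
  for incomparable sets.\<close>

lemma card_uncross_less:
  assumes T: "finite T" "X \<subseteq> T" "Y \<subseteq> T" and XY: "\<not> X \<subseteq> Y" "\<not> Y \<subseteq> X"
  shows "card (X \<inter> Y) * (card T - card (X \<inter> Y)) + card (X \<union> Y) * (card T - card (X \<union> Y))
    < card X * (card T - card X) + card Y * (card T - card Y)"
proof -
  define a p q r where "a = card (X \<inter> Y)" and "p = card (X - Y)" and "q = card (Y - X)"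
    and "r = card (T - (X \<union> Y))"
  have fin: "finite X" "finite Y" using T finite_subset by auto
  have pq: "p > 0" "q > 0" using XY fin by (auto simp: p_def q_def card_gt_0_iff)
  have X: "card X = a + p"
    unfolding a_def p_def using fin(1) by (rule card_Int_Diff)
  have Y: "card Y = a + q"
    unfolding a_def q_def using fin by (metis Int_commute card_Int_Diff)
  have U: "card (X \<union> Y) = a + p + q"
    using card_Un_Int[OF fin] X Y by (simp add: a_def)
  have T': "card T = a + p + q + r"
    using card_Int_Diff[OF T(1), of "X \<union> Y"] T(2,3) U by (simp add: r_def Int_absorb1)
  have d: "a + p + q + r - (a + p) = q + r" "a + p + q + r - (a + q) = p + r"
    "a + p + q + r - a = p + q + r" "a + p + q + r - (a + p + q) = r"
    by auto
  have "a * (p + q + r) + (a + p + q) * r < (a + p) * (q + r) + (a + q) * (p + r)"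
    using pq by (simp add: algebra_simps)
  then show ?thesis unfolding X Y U T' a_def[symmetric] d .
qed

text \<open>While two members cross, they are replaced by their intersection and union.
  Supermodularity keeps the total of \<open>f\<close> from falling, no ordered pair
  \<open>(u, v)\<close> is separated more often, and the measure above drops.\<close>

lemma uncross_mset:
  fixes f :: "'a set \<Rightarrow> real"
  assumes T: "finite T" and f: "intersecting_supermodular_on T f"
    and M: "set_mset M \<subseteq> Pow T - {{}}"
  shows "\<exists>M'. set_mset M' \<subseteq> Pow T - {{}} \<and> laminar (set_mset M') \<and>
    (\<Sum>X\<in>#M. f X) \<le> (\<Sum>X\<in>#M'. f X) \<and>
    (\<forall>u v. (\<Sum>X\<in>#M'. of_bool (v \<in> X \<and> u \<notin> X) :: real) \<le> (\<Sum>X\<in>#M. of_bool (v \<in> X \<and> u \<notin> X)))"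
  using M
proof (induction "\<Sum>X\<in>#M. card X * (card T - card X)" arbitrary: M rule: less_induct)
  case less
  show ?case
  proof (cases "laminar (set_mset M)")
    case True
    with less.prems show ?thesis by blast
  next
    case False
    then obtain X Y where XY: "X \<in># M" "Y \<in># M" "X \<inter> Y \<noteq> {}" "\<not> X \<subseteq> Y" "\<not> Y \<subseteq> X"
      by (auto simp: laminar_def)
    obtain R1 where R1: "M = add_mset X R1" using multi_member_split[OF XY(1)] by blast
    with XY have "Y \<in># R1" by auto
    from multi_member_split[OF this] obtain R where "R1 = add_mset Y R" by blast
    with R1 have R: "M = {#X, Y#} + R" by simp
    define M1 where "M1 = {#X \<inter> Y, X \<union> Y#} + R"
    have sub: "X \<subseteq> T" "Y \<subseteq> T" using XY less.prems by auto
    have M1: "set_mset M1 \<subseteq> Pow T - {{}}"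
      using less.prems XY sub by (auto simp: M1_def R)
    have "(\<Sum>X\<in>#M1. card X * (card T - card X)) < (\<Sum>X\<in>#M. card X * (card T - card X))"
      using card_uncross_less[OF T sub XY(4,5)] by (simp add: M1_def R)
    from less.hyps[OF this M1] obtain M' where
      M': "set_mset M' \<subseteq> Pow T - {{}}" "laminar (set_mset M')"
        "(\<Sum>X\<in>#M1. f X) \<le> (\<Sum>X\<in>#M'. f X)"
        "\<And>u v. (\<Sum>X\<in>#M'. of_bool (v \<in> X \<and> u \<notin> X) :: real) \<le> (\<Sum>X\<in>#M1. of_bool (v \<in> X \<and> u \<notin> X))"
      by blast
    have "(\<Sum>X\<in>#M. f X) \<le> (\<Sum>X\<in>#M1. f X)"
      using f sub XY by (simp add: intersecting_supermodular_on_def M1_def R)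
    moreover have "(\<Sum>X\<in>#M1. of_bool (v \<in> X \<and> u \<notin> X) :: real) \<le> (\<Sum>X\<in>#M. of_bool (v \<in> X \<and> u \<notin> X))" for u v
      by (auto simp: M1_def R)
    ultimately show ?thesis
      using M'(1,2) order_trans[OF _ M'(3)] order_trans[OF M'(4)]
      by (intro exI[of _ M'] conjI allI) blast+
  qed
qed

lemma sum_mset_eq_sum_count:
  fixes g :: "'a \<Rightarrow> real"
  assumes "finite F" "set_mset M \<subseteq> F"
  shows "(\<Sum>x\<in>#M. g x) = (\<Sum>x\<in>F. of_nat (count M x) * g x)"
  using assms(2)
proof (induction M)
  case (add y M)
  have "(\<Sum>x\<in>F. of_nat (count (add_mset y M) x) * g x)
      = (\<Sum>x\<in>F. of_nat (count M x) * g x + (if x = y then g y else 0))"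
    by (intro sum.cong) (auto simp: distrib_right)
  also have "\<dots> = (\<Sum>x\<in>F. of_nat (count M x) * g x) + g y"
    using add.prems assms(1) by (simp add: sum.distrib)
  finally show ?case using add by simp
qed simp

lemma uncross:
  fixes f :: "'a set \<Rightarrow> real" and z :: "'a set \<Rightarrow> nat"
  assumes T: "finite T" and f: "intersecting_supermodular_on T f"
  shows "\<exists>z' :: 'a set \<Rightarrow> nat. laminar {U \<in> Pow T - {{}}. z' U > 0} \<and>
    (\<Sum>U\<in>Pow T - {{}}. of_nat (z U) * f U) \<le> (\<Sum>U\<in>Pow T - {{}}. of_nat (z' U) * f U) \<and>
    (\<forall>u v. (\<Sum>U\<in>Pow T - {{}}. of_nat (z' U) * of_bool (v \<in> U \<and> u \<notin> U) :: real)
       \<le> (\<Sum>U\<in>Pow T - {{}}. of_nat (z U) * of_bool (v \<in> U \<and> u \<notin> U)))"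
proof -
  let ?F = "Pow T - {{}}"
  define M where "M = (\<Sum>U\<in>?F. replicate_mset (z U) U)"
  have fin: "finite ?F" using T by simp
  have M: "set_mset M \<subseteq> ?F" unfolding M_def using fin
    by (subst set_mset_sum) (auto split: if_splits)
  have count: "count M U = z U" if "U \<in> ?F" for U
  proof -
    have "count M U = (\<Sum>X\<in>?F. if X = U then z U else 0)"
      unfolding M_def count_sum by (intro sum.cong) auto
    with that fin show ?thesis by simp
  qed
  have sum_z: "(\<Sum>U\<in>#M. g U) = (\<Sum>U\<in>?F. of_nat (z U) * g U)" for g :: "'a set \<Rightarrow> real"
    unfolding sum_mset_eq_sum_count[OF fin M] by (intro sum.cong) (auto simp: count)
  obtain M' where M': "set_mset M' \<subseteq> ?F" "laminar (set_mset M')"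
      "(\<Sum>X\<in>#M. f X) \<le> (\<Sum>X\<in>#M'. f X)"
      "\<forall>u v. (\<Sum>X\<in>#M'. of_bool (v \<in> X \<and> u \<notin> X) :: real) \<le> (\<Sum>X\<in>#M. of_bool (v \<in> X \<and> u \<notin> X))"
    using uncross_mset[OF T f M] by blast
  have "laminar {U \<in> ?F. count M' U > 0}"
    using M'(2) by (auto simp: laminar_def)
  then show ?thesis
    using M'(3,4) unfolding sum_z sum_mset_eq_sum_count[OF fin M'(1)] by blast
qed

section \<open>Dealing a laminar family into parts\<close>

text \<open>Going inward along the chain, the weight strictly above a set is the weight accumulated
  up to its predecessor, so the differences cancel. The induction splits off the innermost set,
  above which the whole chain lies.\<close>

lemma chain_telescope:
  fixes N :: "int \<Rightarrow> int" and z :: "'a set \<Rightarrow> int"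
  assumes "finite C" "\<forall>X\<in>C. \<forall>Y\<in>C. X \<subseteq> Y \<or> Y \<subseteq> X"
  shows "(\<Sum>U\<in>C. N (\<Sum>X | X \<in> C \<and> U \<subseteq> X. z X) - N (\<Sum>X | X \<in> C \<and> U \<subset> X. z X))
    = N (\<Sum>X\<in>C. z X) - N 0"
  using assms
proof (induction "card C" arbitrary: C)
  case 0
  then show ?case by simp
next
  case (Suc n)
  then have "C \<noteq> {}" by auto
  from finite_has_minimal[OF Suc.prems(1) this]
  obtain m where m: "m \<in> C" "\<And>X. X \<in> C \<Longrightarrow> X \<subseteq> m \<Longrightarrow> m = X" by blast
  have le: "m \<subseteq> X" if "X \<in> C" for X
    using Suc.prems(2) m(1) m(2)[OF that] that by (metis order_refl)
  have above_m: "m \<subseteq> X \<longleftrightarrow> True" "m \<subset> X \<longleftrightarrow> X \<noteq> m" if "X \<in> C" for X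
    using le[OF that] by (simp_all add: psubset_eq eq_commute)
  have m_sets: "{X. X \<in> C \<and> m \<subseteq> X} = C" "{X. X \<in> C \<and> m \<subset> X} = C - {m}"
    by (simp_all add: above_m set_eq_iff cong: conj_cong)
  have not_m: "\<not> U \<subseteq> m" if "U \<in> C - {m}" for U
    using m(2)[of U] that by blast
  have sets: "{X. X \<in> C \<and> U \<subset> X} = {X. X \<in> C - {m} \<and> U \<subset> X}"
    "{X. X \<in> C \<and> U \<subseteq> X} = {X. X \<in> C - {m} \<and> U \<subseteq> X}" if "U \<in> C - {m}" for U
    using not_m[OF that] unfolding set_eq_iff mem_Collect_eq psubset_eq by (metis DiffI Diff_iff singletonD)+
  have "(\<Sum>U\<in>C - {m}. N (\<Sum>X | X \<in> C \<and> U \<subseteq> X. z X) - N (\<Sum>X | X \<in> C \<and> U \<subset> X. z X))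
    = (\<Sum>U\<in>C - {m}. N (\<Sum>X | X \<in> C - {m} \<and> U \<subseteq> X. z X) - N (\<Sum>X | X \<in> C - {m} \<and> U \<subset> X. z X))"
    by (intro sum.cong refl) (simp only: sets)
  also have "\<dots> = N (\<Sum>X\<in>C - {m}. z X) - N 0"
  proof (rule Suc.hyps(1))
    show "n = card (C - {m})" using Suc.hyps(2) Suc.prems(1) m(1) by simp
  qed (use Suc.prems in auto)
  finally show ?case
    unfolding sum.remove[OF Suc.prems(1) m(1)] m_sets by simp
qed

definition weight_above :: "'a set set \<Rightarrow> ('a set \<Rightarrow> nat) \<Rightarrow> 'a set \<Rightarrow> int" where
  "weight_above F z Y = (\<Sum>X | X \<in> F \<and> Y \<subseteq> X. int (z X))"

text \<open>In a laminar family the copies of the sets containing a given point are numbered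
  consecutively from the outside in; the copies of \<open>U\<close> get the numbers in
  \<open>{weight_above F z U - z U <.. weight_above F z U}\<close>. For a counting function \<open>N\<close> of a residue class,
  \<open>relabel F z N U\<close> counts the copies of \<open>U\<close> whose number lies in this class.\<close>

definition relabel :: "'a set set \<Rightarrow> ('a set \<Rightarrow> nat) \<Rightarrow> (int \<Rightarrow> int) \<Rightarrow> 'a set \<Rightarrow> int" where
  "relabel F z N U = N (weight_above F z U) - N (weight_above F z U - int (z U))"

text \<open>Used sets containing the nonempty \<open>Y\<close> meet pairwise, so laminarity makes
  them a chain whose number intervals are adjacent and start at 0.\<close>

lemma sum_relabel_above:
  assumes F: "finite F" and lam: "laminar {U \<in> F. z U > 0}" and Y: "Y \<noteq> {}"
  shows "(\<Sum>U | U \<in> F \<and> Y \<subseteq> U. relabel F z N U) = N (weight_above F z Y) - N 0"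
proof -
  define C where "C = {U \<in> F. Y \<subseteq> U \<and> z U > 0}"
  have finC: "finite C" using F by (simp add: C_def)
  have chain: "\<forall>X\<in>C. \<forall>X'\<in>C. X \<subseteq> X' \<or> X' \<subseteq> X"
    using lam Y unfolding laminar_def C_def by blast
  have above: "weight_above F z U = (\<Sum>X | X \<in> C \<and> U \<subseteq> X. int (z X))" if "Y \<subseteq> U" for U
    unfolding weight_above_def using F that by (intro sum.mono_neutral_right) (auto simp: C_def)
  have above': "weight_above F z U - int (z U) = (\<Sum>X | X \<in> C \<and> U \<subset> X. int (z X))" if U: "U \<in> C" for U
  proof -
    have "weight_above F z U = (\<Sum>X\<in>insert U {X. X \<in> C \<and> U \<subset> X}. int (z X))"
      using U by (subst above) (auto simp: C_def intro!: sum.cong)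
    with finC show ?thesis by simp
  qed
  \<comment> \<open>Sets of multiplicity 0 have an empty number interval and contribute
    nothing.\<close>
  have "(\<Sum>U | U \<in> F \<and> Y \<subseteq> U. relabel F z N U) = (\<Sum>U\<in>C. relabel F z N U)"
    using F by (intro sum.mono_neutral_right) (auto simp: C_def relabel_def)
  also have "\<dots> = (\<Sum>U\<in>C. N (\<Sum>X | X \<in> C \<and> U \<subseteq> X. int (z X)) - N (\<Sum>X | X \<in> C \<and> U \<subset> X. int (z X)))"
    unfolding relabel_def using above' by (intro sum.cong) (auto simp: above C_def)
  also have "\<dots> = N (\<Sum>X\<in>C. int (z X)) - N 0"
    by (rule chain_telescope[OF finC chain])
  also have "(\<Sum>X\<in>C. int (z X)) = weight_above F z Y"
    by (subst above) (auto simp: C_def intro!: sum.cong)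
  finally show ?thesis .
qed

text \<open>Among the used sets around \<open>v\<close>, those containing \<open>u\<close> too are
  the outer ones. The copies separating \<open>v\<close> from \<open>u\<close> are therefore
  numbered consecutively, and \<open>N\<close> is evaluated at the two ends.\<close>

lemma sum_relabel_cut:
  assumes F: "finite F" and lam: "laminar {U \<in> F. z U > 0}"
  shows "(\<Sum>U\<in>F. relabel F z N U * of_bool (v \<in> U \<and> u \<notin> U))
    = N (weight_above F z {v}) - N (weight_above F z {u, v})"
proof -
  have "(\<Sum>U\<in>F. relabel F z N U * of_bool (v \<in> U \<and> u \<notin> U))
      = (\<Sum>U\<in>{U. U \<in> F \<and> {v} \<subseteq> U} - {U. U \<in> F \<and> {u, v} \<subseteq> U}. relabel F z N U)"
    using F by (intro sum.mono_neutral_cong_right) auto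
  also have "\<dots> = (\<Sum>U | U \<in> F \<and> {v} \<subseteq> U. relabel F z N U) - (\<Sum>U | U \<in> F \<and> {u, v} \<subseteq> U. relabel F z N U)"
    using F by (intro sum_diff) auto
  finally show ?thesis 
    using sum_relabel_above[OF F lam, of "{v}" N] sum_relabel_above[OF F lam, of "{u, v}" N] by simp
qed

text \<open>Hermite's identity for \<open>x / k\<close>. Raising \<open>x\<close> by 1 shifts the
  index: the term \<open>x div k\<close> leaves and \<open>(x + k) div k\<close>, larger by 1,
  enters.\<close>

lemma sum_shifted_div:
  fixes k :: nat
  assumes "k > 0"
  shows "(\<Sum>j<k. (x + int j) div int k) = x"
proof -
  have step: "(\<Sum>j<k. (x + 1 + int j) div int k) = (\<Sum>j<k. (x + int j) div int k) + 1" for x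
  proof -
    have "(\<Sum>j<k. (x + 1 + int j) div int k) = (\<Sum>j<k. (x + int (Suc j)) div int k)"
      by (simp add: ac_simps)
    also have "\<dots> = (\<Sum>j<Suc k. (x + int j) div int k) - x div int k"
      by (subst sum.lessThan_Suc_shift) simp
    also have "\<dots> = (\<Sum>j<k. (x + int j) div int k) + 1"
      using assms by simp
    finally show ?thesis .
  qed
  show ?thesis
  proof (induction x rule: int_induct[of _ 0])
    case base
    show ?case by simp
  next
    case (step1 i)
    then show ?case using step[of i] by simp
  next
    case (step2 i)
    then show ?case using step[of "i - 1"] by simp
  qed
qed

text \<open>Shifting by \<open>k * c\<close> changes the quotient by exactly \<open>c\<close>, so an
  integer threshold respected by the average share of an interval is respected by every residue
  class.\<close>

lemma div_diff_bounds:
  fixes k :: nat and a b c :: int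
  assumes "k > 0"
  shows "a - b \<le> int k * c \<Longrightarrow> (a + j) div int k - (b + j) div int k \<le> c"
    and "a - b \<ge> int k * c \<Longrightarrow> (a + j) div int k - (b + j) div int k \<ge> c"
proof -
  have *: "(b + j + int k * c) div int k = (b + j) div int k + c" using assms by simp
  show "(a + j) div int k - (b + j) div int k \<le> c" if "a - b \<le> int k * c"
    using zdiv_mono1[of "a + j" "b + j + int k * c" "int k"] that assms * by simp
  show "(a + j) div int k - (b + j) div int k \<ge> c" if "a - b \<ge> int k * c"
    using zdiv_mono1[of "b + j + int k * c" "a + j" "int k"] that assms * by simp
qed


section \<open>Rounding for the two sides together\<close>

lemma roundable_pair:
  fixes hd tl :: "'e \<Rightarrow> 'v" and S T :: "'v set" and fT fS :: "'v set \<Rightarrow> real"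
  assumes fin: "finite T" "finite S" and disj: "S \<inter> T = {}"
    and fT: "intersecting_supermodular_on T fT" and fS: "intersecting_supermodular_on S fS"
  shows "roundable ((Pow T - {{}}) <+> (Pow S - {{}})) E
    (case_sum (\<lambda>U e. of_bool (hd e \<in> U \<and> tl e \<notin> U)) (\<lambda>W e. of_bool (tl e \<in> W \<and> hd e \<notin> W)))
    (case_sum fT fS)"
    (is "roundable (?A <+> ?B) E ?M ?f")
  unfolding roundable_def
proof (intro allI impI)
  fix c L u :: "'e \<Rightarrow> real" and z :: "'v set + 'v set \<Rightarrow> nat" and k :: nat
  assume c: "\<forall>e\<in>E. c e \<in> \<int>" and LU: "\<forall>e\<in>E. 0 \<le> L e \<and> L e \<le> u e" and k: "0 < k"
  have finAB: "finite ?A" "finite ?B" using fin by auto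
  note sum_AB = sum.Plus[OF finAB]
  let ?R = "relaxed_dual (?A <+> ?B) E ?M ?f L u"
  obtain zT :: "'v set \<Rightarrow> nat" where zT: "laminar {U \<in> ?A. zT U > 0}"
      "(\<Sum>U\<in>?A. of_nat (z (Inl U)) * fT U) \<le> (\<Sum>U\<in>?A. of_nat (zT U) * fT U)"
      "\<And>u v. (\<Sum>U\<in>?A. of_nat (zT U) * of_bool (v \<in> U \<and> u \<notin> U) :: real)
         \<le> (\<Sum>U\<in>?A. of_nat (z (Inl U)) * of_bool (v \<in> U \<and> u \<notin> U))"
    using uncross[OF fin(1) fT, of "z \<circ> Inl"] by auto
  obtain zS :: "'v set \<Rightarrow> nat" where zS: "laminar {U \<in> ?B. zS U > 0}"
      "(\<Sum>U\<in>?B. of_nat (z (Inr U)) * fS U) \<le> (\<Sum>U\<in>?B. of_nat (zS U) * fS U)"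
      "\<And>u v. (\<Sum>U\<in>?B. of_nat (zS U) * of_bool (v \<in> U \<and> u \<notin> U) :: real)
         \<le> (\<Sum>U\<in>?B. of_nat (z (Inr U)) * of_bool (v \<in> U \<and> u \<notin> U))"
    using uncross[OF fin(2) fS, of "z \<circ> Inr"] by auto
  define z' where "z' = case_sum zT zS"
  have uncrossed: "?R (\<lambda>e. of_nat k * c e) (\<lambda>j. of_nat (z j)) \<le> ?R (\<lambda>e. of_nat k * c e) (\<lambda>j. of_nat (z' j))"
  proof (rule relaxed_dual_mono)
    show "(\<Sum>j\<in>?A <+> ?B. of_nat (z j) * ?f j) \<le> (\<Sum>j\<in>?A <+> ?B. of_nat (z' j) * ?f j)"
      unfolding sum_AB using zT(2) zS(2) by (simp add: z'_def)
    show "(\<Sum>j\<in>?A <+> ?B. of_nat (z' j) * ?M j e) \<le> (\<Sum>j\<in>?A <+> ?B. of_nat (z j) * ?M j e)" for e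
      \<comment> \<open>Arcs enter the sets in \<open>T\<close> but leave those in \<open>S\<close>,
        hence the swapped endpoints.\<close>
      unfolding sum_AB using zT(3)[of "hd e" "tl e"] zS(3)[of "tl e" "hd e"]
      by (simp add: z'_def add_mono)
  qed (use LU in auto)
  \<comment> \<open>The \<open>k\<close> parts share the copies cyclically. Numbering the copies on the \<open>S\<close> side by nonpositive
    integers makes the copies covering an arc a single interval of integers, so that every part
    gets its fair share of this interval up to rounding.\<close>
  define N where "N j x = (x + int j) div int k" for j x
  define N' where "N' j x = - N j (- x)" for j x
  define wT where "wT j U = nat (relabel ?A zT (N j) U)" for j U
  define wS where "wS j U = nat (relabel ?B zS (N' j) U)" for j U
  define w where "w j = case_sum (wT j) (wS j)" for j
  have N_mono: "N j x \<le> N j y" if "x \<le> y" for j x y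
    unfolding N_def using that k by (intro zdiv_mono1) auto
  have N_0: "N j 0 = 0" if "j < k" for j
    using that by (simp add: N_def)
  have N_sum: "(\<Sum>j<k. N j x) = x" for x
    unfolding N_def by (rule sum_shifted_div[OF k])
  then have N'_sum: "(\<Sum>j<k. N' j x) = x" for x
    by (simp add: N'_def sum_negf)
  \<comment> \<open>Monotonicity makes the counts nonnegative, so \<open>nat\<close> truncates
    nothing.\<close>
  have wT: "int (wT j U) = relabel ?A zT (N j) U" for j U
    unfolding wT_def relabel_def using N_mono by simp
  have wS: "int (wS j U) = relabel ?B zS (N' j) U" for j U
    unfolding wS_def relabel_def using N_mono by (simp add: N'_def)
  have sum_wT: "(\<Sum>j<k. int (wT j U)) = int (zT U)" for U
    unfolding wT relabel_def sum_subtractf N_sum by simp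
  have sum_wS: "(\<Sum>j<k. int (wS j U)) = int (zS U)" for U
    unfolding wS relabel_def sum_subtractf N'_sum by simp
  have sum_w: "(\<Sum>j<k. of_nat (w j i) :: real) = of_nat (z' i)" for i
    using sum_wT sum_wS by (cases i) (simp_all add: w_def z'_def flip: of_nat_sum)
  have sum_w_mult: "(\<Sum>j<k. \<Sum>i\<in>X. of_nat (w j i) * r i :: real) = (\<Sum>i\<in>X. of_nat (z' i) * r i)" for X r
    by (subst sum.swap) (simp add: sum_w flip: sum_distrib_right)
  define cov where "cov j e = (\<Sum>i\<in>?A <+> ?B. of_nat (w j i) * ?M i e)" for j e
  have sum_cov: "(\<Sum>j<k. cov j e) = (\<Sum>i\<in>?A <+> ?B. of_nat (z' i) * ?M i e)" for e
    unfolding cov_def by (rule sum_w_mult)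
  have cov_interval: "\<exists>p q. \<forall>j<k. cov j e = of_int (N j p - N j q)" for e
  proof -
    let ?P = "weight_above ?A zT" and ?Q = "weight_above ?B zS"
    have P0: "?P Y = 0" if "\<not> Y \<subseteq> T" for Y
      unfolding weight_above_def using that by (intro sum.neutral) auto
    have Q0: "?Q Y = 0" if "\<not> Y \<subseteq> S" for Y
      unfolding weight_above_def using that by (intro sum.neutral) auto
    have cov: "cov j e = of_int ((N j (?P {hd e}) - N j (?P {tl e, hd e}))
        + (N' j (?Q {tl e}) - N' j (?Q {hd e, tl e})))" for j
    proof -
      have "cov j e = of_int ((\<Sum>U\<in>?A. int (wT j U) * of_bool (hd e \<in> U \<and> tl e \<notin> U))
          + (\<Sum>W\<in>?B. int (wS j W) * of_bool (tl e \<in> W \<and> hd e \<notin> W)))"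
        unfolding cov_def sum_AB by (simp add: w_def)
      then show ?thesis
        unfolding wT wS sum_relabel_cut[OF finAB(1) zT(1)] sum_relabel_cut[OF finAB(2) zS(1)] .
    qed
    \<comment> \<open>In the first two cases only one side can cover \<open>e\<close>. In the third,
      no set in use contains both ends, and the copies from \<open>S\<close> and \<open>T\<close>
      occupy \<open>(-Q, 0]\<close> and \<open>(0, P]\<close>, where \<open>Q\<close> and
      \<open>P\<close> are the weights at tail and head: two intervals meeting at 0.\<close>
    consider "hd e \<notin> T" | "hd e \<in> T" "tl e \<in> T" | "hd e \<in> T" "tl e \<notin> T" by blast
    then show ?thesis
    proof cases
      case 1
      then have "cov j e = of_int (N j (- ?Q {hd e, tl e}) - N j (- ?Q {tl e}))" for j
        unfolding cov by (simp add: P0 N'_def)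
      then show ?thesis by blast
    next
      case 2
      with disj have "tl e \<notin> S" by blast
      then have "cov j e = of_int (N j (?P {hd e}) - N j (?P {tl e, hd e}))" for j
        unfolding cov by (simp add: Q0 N'_def)
      then show ?thesis by blast
    next
      case 3
      with disj have "hd e \<notin> S" by blast
      with 3 have "cov j e = of_int (N j (?P {hd e}) - N j (- ?Q {tl e}))" if "j < k" for j
        unfolding cov using N_0[OF that] by (simp add: P0 Q0 N'_def)
      then show ?thesis by blast
    qed
  qed
  have "(\<Sum>j<k. slack_val (L e) (u e) (c e - cov j e))
      = slack_val (L e) (u e) (of_nat k * c e - (\<Sum>j<k. cov j e))" if e: "e \<in> E" for e
  proof -
    obtain p q where pq: "\<forall>j<k. cov j e = of_int (N j p - N j q)" using cov_interval by blast
    obtain d :: int where d: "c e = of_int d" using c e by (auto elim: Ints_cases)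
    \<comment> \<open>Since \<open>c e\<close> is an integer, comparing the interval length
      \<open>p - q\<close> with \<open>k * d\<close> fixes the sign of the slack for all parts at
      once.\<close>
    have "(\<forall>j\<in>{..<k}. c e - cov j e \<ge> 0) \<or> (\<forall>j\<in>{..<k}. c e - cov j e \<le> 0)"
    proof (cases "p - q \<le> int k * d")
      case True
      then have "N j p - N j q \<le> d" for j unfolding N_def by (rule div_diff_bounds(1)[OF k])
      then have "\<forall>j\<in>{..<k}. c e - cov j e \<ge> 0" using pq d by (simp del: of_int_diff)
      then show ?thesis ..
    next
      case False
      then have "int k * d \<le> p - q" by simp
      then have "d \<le> N j p - N j q" for j unfolding N_def by (rule div_diff_bounds(2)[OF k])
      then have "\<forall>j\<in>{..<k}. c e - cov j e \<le> 0" using pq d by (simp del: of_int_diff)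
      then show ?thesis ..
    qed
    from slack_val_sum_same_sign[OF this, of "L e" "u e"] show ?thesis
      by (simp add: sum_subtractf)
  qed
  then have slack: "(\<Sum>j<k. \<Sum>e\<in>E. slack_val (L e) (u e) (c e - cov j e))
      = (\<Sum>e\<in>E. slack_val (L e) (u e) (of_nat k * c e - (\<Sum>j<k. cov j e)))"
    by (subst sum.swap) simp
  have average: "?R (\<lambda>e. of_nat k * c e) (\<lambda>i. of_nat (z' i)) = (\<Sum>j<k. ?R c (\<lambda>i. of_nat (w j i)))"
    unfolding relaxed_dual_def cov_def[symmetric] sum.distrib sum_w_mult slack sum_cov ..
  show "\<exists>w :: 'v set + 'v set \<Rightarrow> nat. ?R (\<lambda>e. of_nat k * c e) (\<lambda>j. of_nat (z j)) \<le> of_nat k * ?R c (\<lambda>j. of_nat (w j))"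
  proof (rule ccontr)
    assume "\<not> ?thesis"
    then have "of_nat k * ?R c (\<lambda>i. of_nat (w j i)) < ?R (\<lambda>e. of_nat k * c e) (\<lambda>j. of_nat (z j))" for j
      by (auto simp: not_le)
    then have "(\<Sum>j<k. of_nat k * ?R c (\<lambda>i. of_nat (w j i))) < (\<Sum>j<k. ?R (\<lambda>e. of_nat k * c e) (\<lambda>j. of_nat (z j)))"
      using k by (intro sum_strict_mono) auto
    then show False
      using uncrossed k by (simp add: average flip: sum_distrib_left)
  qed
qed

section \<open>The bicut system\<close>

text \<open>Comparable sets give equality. Incomparable sets that meet have at least two elements
  each, so the left side is 2, while positivity of \<open>b\<close> makes each term on the right at
  least 1.\<close>

lemma intersecting_supermodular_degree_or_one:
  fixes b :: "'v \<Rightarrow> int"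
  assumes "\<forall>v\<in>T. b v > 0"
  shows "intersecting_supermodular_on T (\<lambda>U. if is_singleton U then of_int (b (the_elem U)) else 1)"
    (is "intersecting_supermodular_on T ?f")
  unfolding intersecting_supermodular_on_def
proof (intro allI impI)
  fix X Y assume XY: "X \<subseteq> T" "Y \<subseteq> T" "X \<inter> Y \<noteq> {}"
  have ge1: "1 \<le> ?f U" if "U \<subseteq> T" for U
  proof (cases "is_singleton U")
    case True
    then obtain v where "U = {v}" by (auto simp: is_singleton_def)
    with assms that show ?thesis by force
  qed simp
  consider "X \<subseteq> Y" | "Y \<subseteq> X" | "\<not> X \<subseteq> Y" "\<not> Y \<subseteq> X" by blast
  then show "?f X + ?f Y \<le> ?f (X \<inter> Y) + ?f (X \<union> Y)"
  proof cases
    case 1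
    then have "X \<inter> Y = X" "X \<union> Y = Y" by auto
    then show ?thesis by simp
  next
    case 2
    then have "X \<inter> Y = Y" "X \<union> Y = X" by auto
    then show ?thesis by simp
  next
    case 3
    with XY(3) have "\<not> is_singleton X" "\<not> is_singleton Y" by (auto simp: is_singleton_def)
    moreover have "1 \<le> ?f (X \<inter> Y)" "1 \<le> ?f (X \<union> Y)" using ge1[of "X \<inter> Y"] ge1[of "X \<union> Y"] XY(1,2) by blast+
    ultimately show ?thesis by simp
  qed
qed

theorem mainTheorem1:
  fixes G :: "('v, 'b) pre_digraph" and S T :: "'v set" and b :: "'v \<Rightarrow> int"
  assumes "fin_digraph G" and "loopfree_digraph G"
    and "S \<union> T = verts G" and "S \<inter> T = {}" and "S \<noteq> {}" and "T \<noteq> {}"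
    and "\<forall>e \<in> arcs G. \<not> (tail G e \<in> T \<and> head G e \<in> S)"
    and "\<forall>v \<in> verts G. b v > 0"
  shows "box_TDI (bicut_idx G S T) (arcs G) (bicut_coef G) (bicut_rhs b)"
proof -
  interpret fin_digraph G by fact
  define I0 :: "('v, 'b) bicut_con set" where
    "I0 = InDeg ` T \<union> OutDeg ` S \<union> Cut ` {U. bicut_set G T U}"
  have fin: "finite S" "finite T" using assms(3) finite_verts by (metis finite_Un)+
  interpret nonneg_system I0 "arcs G" "bicut_coef G" "bicut_rhs b" NonNeg
  proof
    have "{U. bicut_set G T U} \<subseteq> Pow (verts G)" by (auto simp: bicut_set_def)
    then show "finite I0"
      unfolding I0_def using fin finite_verts by (auto dest: finite_subset)
  qed (auto simp: I0_def inj_on_def)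
  define f :: "'v set \<Rightarrow> real" where "f U = (if is_singleton U then of_int (b (the_elem U)) else 1)" for U
  \<comment> \<open>Each set is sent to its strongest row: on singletons the degree bound beats the
    cut bound 1. Arcs leaving \<open>W\<close> are those entering its complement, which contains
    \<open>T\<close>.\<close>
  define g :: "'v set + 'v set \<Rightarrow> ('v, 'b) bicut_con" where
    "g = case_sum (\<lambda>U. if is_singleton U then InDeg (the_elem U) else Cut U)
       (\<lambda>W. if is_singleton W then OutDeg (the_elem W) else Cut (verts G - W))"
  \<comment> \<open>A cut at a singleton shares its image with a degree row and has the weaker bound
    1. The value at \<open>NonNeg\<close> is arbitrary, as \<open>I0\<close> has no such
    index.\<close>
  define h :: "('v, 'b) bicut_con \<Rightarrow> 'v set + 'v set" where
    "h i = (case i of InDeg v \<Rightarrow> Inl {v} | OutDeg v \<Rightarrow> Inr {v}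
       | Cut U \<Rightarrow> if U \<subseteq> T then Inl U else Inr (verts G - U) | NonNeg e \<Rightarrow> undefined)" for i
  let ?J = "(Pow T - {{}}) <+> (Pow S - {{}})"
  let ?M = "case_sum (\<lambda>U e. of_bool (head G e \<in> U \<and> tail G e \<notin> U))
    (\<lambda>W e. of_bool (tail G e \<in> W \<and> head G e \<notin> W)) :: 'v set + 'v set \<Rightarrow> 'b \<Rightarrow> real"
  have f_ge1: "f U \<in> \<int> \<and> 1 \<le> f U" if "U \<subseteq> S \<or> U \<subseteq> T" for U
  proof (cases "is_singleton U")
    case True
    then obtain v where v: "U = {v}" by (auto simp: is_singleton_def)
    with that assms(3) have "v \<in> verts G" by auto
    with assms(8) have "1 \<le> b v" by force
    with v show ?thesis by (simp add: f_def)
  qed (simp add: f_def)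
  have "roundable ?J (arcs G) ?M (case_sum f f)"
    using fin assms(4) unfolding f_def
    by (intro roundable_pair intersecting_supermodular_degree_or_one) (use assms(3,8) in auto)
  moreover have "case_sum f f j \<in> \<int> \<and> 0 \<le> case_sum f f j" if "j \<in> ?J" for j
  proof (cases j)
    case (Inl U)
    with that f_ge1[of U] show ?thesis by auto
  next
    case (Inr W)
    with that f_ge1[of W] show ?thesis by auto
  qed
  moreover have "g j \<in> I0 \<and> (\<forall>e\<in>arcs G. bicut_coef G (g j) e = ?M j e) \<and> bicut_rhs b (g j) = case_sum f f j"
    if "j \<in> ?J" for j
  proof (cases j)
    case (Inl U)
    with that have U: "U \<subseteq> T" "U \<noteq> {}" by auto
    show ?thesis
    proof (cases "is_singleton U")
      case True
      then obtain v where "U = {v}" by (auto simp: is_singleton_def)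
      with U Inl show ?thesis by (auto simp: g_def f_def I0_def delta_in_def)
    next
      case False
      have "bicut_set G T U" using U assms(3) by (auto simp: bicut_set_def)
      with False Inl show ?thesis by (auto simp: g_def f_def I0_def delta_in_def)
    qed
  next
    case (Inr W)
    with that have W: "W \<subseteq> S" "W \<noteq> {}" by auto
    show ?thesis
    proof (cases "is_singleton W")
      case True
      then obtain v where "W = {v}" by (auto simp: is_singleton_def)
      with W Inr show ?thesis by (auto simp: g_def f_def I0_def delta_out_def)
    next
      case False
      have "bicut_set G T (verts G - W)"
        using W assms(3,4) by (auto simp: bicut_set_def)
      with False Inr show ?thesis by (auto simp: g_def f_def I0_def delta_in_def)
    qed
  qed
  moreover have "h i \<in> ?J \<and> (\<forall>e\<in>arcs G. ?M (h i) e = bicut_coef G i e) \<and> bicut_rhs b i \<le> case_sum f f (h i)"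
    if i: "i \<in> I0" for i
  proof -
    consider v where "i = InDeg v" "v \<in> T" | v where "i = OutDeg v" "v \<in> S"
      | U where "i = Cut U" "bicut_set G T U" "U \<subseteq> T"
      | U where "i = Cut U" "bicut_set G T U" "\<not> U \<subseteq> T"
      using i unfolding I0_def by blast
    then show ?thesis
    proof cases
      case (3 U)
      \<comment> \<open>If \<open>U\<close> qualifies only through \<open>T \<subseteq> U\<close>,
        nonemptiness of \<open>T\<close> rules out the empty set.\<close>
      then have "U \<noteq> {}" using assms(6) by (auto simp: bicut_set_def)
      with 3 f_ge1[of U] show ?thesis by (auto simp: h_def delta_in_def)
    next
      case (4 U)
      then have U: "T \<subseteq> U" "U \<subset> verts G" by (auto simp: bicut_set_def)
      then have "verts G - U \<subseteq> S" "verts G - U \<noteq> {}" using assms(3) by auto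
      with 4 f_ge1[of "verts G - U"] show ?thesis by (auto simp: h_def delta_in_def)
    qed (auto simp: h_def f_def delta_in_def delta_out_def)
  qed
  ultimately have "box_TDI I (arcs G) (bicut_coef G) (bicut_rhs b)"
    using fin by (intro box_TDI_if_roundable[where J = ?J and M = ?M and f = "case_sum f f" and g = g and h = h])
      (auto split: sum.splits)
  then show ?thesis by (simp add: I0_def bicut_idx_def)
qed

end
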